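(* Let $G$ be a finite simple graph without isolated vertices on $[n]$, and let $D\subseteq[n]$ be a dominating set of $G$. Let $\mathbf{k}\in\mathbb{N}^n$ be the vector with $$k_i=\begin{cases}2,&\text{if } i\in D,\\ \deg_G(i)+1,&\text{if } i\notin D.\end{cases}$$ Then $\mathrm{NI}_{\mathbf{k}}(G)$ is the edge ideal of a graph.
   Context: $K$ is a field and $S=K[x_1,\ldots,x_n]$. $N_G[i]$ is the closed neighborhood of $i$; $\mathbf{x}_W=\prod_{j\in W}x_j$. For $\mathbf{k}=(k_1,\ldots,k_n)$ with $1\le k_i\le\deg_G(i)+1$, the $\mathbf{k}$-neighborhood ideal is $\mathrm{NI}_{\mathbf{k}}(G)=\sum_{i=1}^n(\mathbf{x}_W: W\subseteq N_G[i],\ |W|=k_i)\subseteq S$. A dominating set of $G$ is a set $D\subseteq[n]$ with $N_G[i]\cap D\neq\emptyset$ for all $i\in[n]$. The edge ideal of a simple graph $H$ on $[n]$ is $I(H)=(x_ix_j:\{i,j\}\in E(H))\subseteq S$. *)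

theory Defs
  imports "HOL-Library.Poly_Mapping" "HOL-Algebra.Ideal"
begin

subsection \<open>Finite simple graphs\<close>

text \<open>A graph is given by its vertex set \<open>V\<close> and its set \<open>E\<close> of edges, each a two-element subset
  of \<open>V\<close>.\<close>

definition simple_graph :: "'a set \<Rightarrow> 'a set set \<Rightarrow> bool" where
  "simple_graph V E \<longleftrightarrow> finite V \<and> (\<forall>e\<in>E. e \<subseteq> V \<and> card e = 2)"

definition nbhd :: "'a set set \<Rightarrow> 'a \<Rightarrow> 'a set" where
  "nbhd E i = {j. {i, j} \<in> E}"

definition closed_nbhd :: "'a set set \<Rightarrow> 'a \<Rightarrow> 'a set" where
  "closed_nbhd E i = insert i (nbhd E i)"

definition degree :: "'a set set \<Rightarrow> 'a \<Rightarrow> nat" where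
  "degree E i = card (nbhd E i)"

definition no_isolated_vertices :: "'a set \<Rightarrow> 'a set set \<Rightarrow> bool" where
  "no_isolated_vertices V E \<longleftrightarrow> (\<forall>i\<in>V. nbhd E i \<noteq> {})"

definition dominating_set :: "'a set \<Rightarrow> 'a set set \<Rightarrow> 'a set \<Rightarrow> bool" where
  "dominating_set V E D \<longleftrightarrow> D \<subseteq> V \<and> (\<forall>i\<in>V. closed_nbhd E i \<inter> D \<noteq> {})"


subsection \<open>The polynomial ring in \<open>n\<close> variables\<close>

text \<open>A polynomial maps each exponent vector to its coefficient, both finitely supported; the type
  has countably many variables \<open>x\<^sub>0, x\<^sub>1, \<dots>\<close>. The ring \<open>K[x\<^sub>1, \<dots>, x\<^sub>n]\<close> consists of the polynomials
  involving only \<open>x\<^sub>1, \<dots>, x\<^sub>n\<close>.\<close>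

type_synonym 'k mpoly = "(nat \<Rightarrow>\<^sub>0 nat) \<Rightarrow>\<^sub>0 'k"

definition var :: "nat \<Rightarrow> 'k::field mpoly" where
  "var i = Poly_Mapping.single (Poly_Mapping.single i 1) 1"

definition mpoly_ring :: "nat \<Rightarrow> 'k::field mpoly ring" where
  "mpoly_ring n =
    \<lparr>carrier = {p. \<forall>m\<in>Poly_Mapping.keys p. Poly_Mapping.keys m \<subseteq> {1..n}},
     mult = (*), one = 1, zero = 0, add = (+)\<rparr>"

lemma cring_mpoly_ring: "cring (mpoly_ring n :: 'k::field mpoly ring)"
proof -
  let ?R = "mpoly_ring n :: 'k mpoly ring"
  have add_closed: "x + y \<in> carrier ?R" if "x \<in> carrier ?R" "y \<in> carrier ?R" for x y
    using that Poly_Mapping.keys_add[of x y] by (auto simp: mpoly_ring_def)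
  have mult_closed: "x * y \<in> carrier ?R" if xy: "x \<in> carrier ?R" "y \<in> carrier ?R" for x y
  proof -
    have "Poly_Mapping.keys m \<subseteq> {1..n}" if m: "m \<in> Poly_Mapping.keys (x * y)" for m
    proof -
      obtain a b where ab: "m = a + b" "a \<in> Poly_Mapping.keys x" "b \<in> Poly_Mapping.keys y"
        using m keys_mult[of x y] by blast
      then show ?thesis
        using xy Poly_Mapping.keys_add[of a b] by (force simp: mpoly_ring_def)
    qed
    then show ?thesis by (simp add: mpoly_ring_def)
  qed
  have uminus_closed: "- x \<in> carrier ?R" if "x \<in> carrier ?R" for x
    using that by (auto simp: mpoly_ring_def)
  have ops: "mult ?R = (*)" "one ?R = 1" "zero ?R = 0" "add ?R = (+)"
    by (simp_all add: mpoly_ring_def)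
  have const_closed: "1 \<in> carrier ?R" "0 \<in> carrier ?R"
    by (simp_all add: mpoly_ring_def)
  show ?thesis
  proof (rule cringI)
    show "abelian_group ?R"
    proof (rule abelian_groupI)
      show "\<exists>y\<in>carrier ?R. y \<oplus>\<^bsub>?R\<^esub> x = \<zero>\<^bsub>?R\<^esub>" if "x \<in> carrier ?R" for x
        using uminus_closed[OF that] by (intro bexI[of _ "- x"]) (simp_all add: ops)
    qed (auto simp: ops const_closed add_closed algebra_simps)
    show "comm_monoid ?R"
      by (rule comm_monoidI) (auto simp: ops const_closed mult_closed algebra_simps)
  qed (auto simp: ops algebra_simps)
qed


subsection \<open>Edge ideals and neighborhood ideals\<close>

definition sqfree_monom :: "nat set \<Rightarrow> 'k::field mpoly" where
  "sqfree_monom W = (\<Prod>j\<in>W. var j)"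

definition edge_ideal :: "nat \<Rightarrow> nat set set \<Rightarrow> 'k::field mpoly set" where
  "edge_ideal n E = Idl\<^bsub>mpoly_ring n\<^esub> {var i * var j | i j. {i, j} \<in> E}"

definition ideal_sum :: "('r, 'm) ring_scheme \<Rightarrow> 'i set \<Rightarrow> ('i \<Rightarrow> 'r set) \<Rightarrow> 'r set" where
  "ideal_sum R A J = {\<Oplus>\<^bsub>R\<^esub>i\<in>A. f i | f. \<forall>i\<in>A. f i \<in> J i}"

definition nbhd_ideal :: "nat \<Rightarrow> nat set set \<Rightarrow> (nat \<Rightarrow> nat) \<Rightarrow> 'k::field mpoly set" where
  "nbhd_ideal n E k = ideal_sum (mpoly_ring n) {1..n}
     (\<lambda>i. Idl\<^bsub>mpoly_ring n\<^esub> {sqfree_monom W | W. W \<subseteq> closed_nbhd E i \<and> card W = k i})"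

end

theory Submission
  imports Defs
begin

text \<open>
  A sum of ideals is generated by the union of generating sets of its summands
  (\<open>ideal_sum_genideal\<close>), so two sets of monomials have to be compared. The vertices \<open>d \<in> D\<close>
  contribute the quadrics \<open>x\<^sub>a x\<^sub>b\<close> with \<open>a \<noteq> b\<close> in \<open>N[d]\<close>: these pairs form the edges of \<open>H\<close>.
  A vertex \<open>i \<notin> D\<close> contributes the single monomial of its whole closed neighbourhood. As \<open>D\<close> is
  dominating, \<open>i\<close> has a neighbour \<open>d \<in> D\<close>; then \<open>{i, d}\<close> is contained in both \<open>N[i]\<close> and \<open>N[d]\<close>,
  so this monomial is a multiple of the quadric \<open>x\<^sub>i x\<^sub>d\<close>, which is already present, and it adds
  nothing to the ideal.
\<close>

section \<open>Sums of ideals\<close>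

context ring
begin

lemma ideal_sum_empty: "ideal_sum R {} J = {\<zero>}"
  by (auto simp: ideal_sum_def)

lemma ideal_sum_insert:
  assumes "finite A" "a \<notin> A" and J: "\<And>i. i \<in> insert a A \<Longrightarrow> J i \<subseteq> carrier R"
  shows "ideal_sum R (insert a A) J = J a <+>\<^bsub>R\<^esub> ideal_sum R A J"
proof -
  have split: "(\<Oplus>i\<in>insert a A. f i) = f a \<oplus> (\<Oplus>i\<in>A. f i)"
    if "\<forall>i\<in>insert a A. f i \<in> J i" for f
    using that J assms by (intro finsum_insert) auto
  show ?thesis
  proof (intro equalityI subsetI)
    fix x assume "x \<in> ideal_sum R (insert a A) J"
    then show "x \<in> J a <+>\<^bsub>R\<^esub> ideal_sum R A J"
      using split by (fastforce simp: ideal_sum_def set_add_def')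
  next
    fix x assume "x \<in> J a <+>\<^bsub>R\<^esub> ideal_sum R A J"
    then obtain y f where y: "y \<in> J a" and f: "\<forall>i\<in>A. f i \<in> J i"
      and x: "x = y \<oplus> (\<Oplus>i\<in>A. f i)"
      by (auto simp: ideal_sum_def set_add_def')
    let ?g = "f(a := y)"
    have g: "\<forall>i\<in>insert a A. ?g i \<in> J i" using y f by auto
    have "(\<Oplus>i\<in>A. ?g i) = (\<Oplus>i\<in>A. f i)"
      using \<open>a \<notin> A\<close> f J by (intro finsum_cong') auto
    then have "x = (\<Oplus>i\<in>insert a A. ?g i)" using split[OF g] x by simp
    then show "x \<in> ideal_sum R (insert a A) J" using g by (auto simp: ideal_sum_def)
  qed
qed

text \<open>Splitting off one summand at a time reduces this to \<open>Idl (I \<union> J) = I <+> J\<close> for two ideals.\<close>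

lemma ideal_sum_genideal:
  assumes "finite A" and "\<And>i. i \<in> A \<Longrightarrow> S i \<subseteq> carrier R"
  shows "ideal_sum R A (\<lambda>i. Idl (S i)) = Idl (\<Union>i\<in>A. S i)"
  using assms
proof (induction A rule: finite_induct)
  case empty
  have "Idl {} = {\<zero>}"
    using genideal_minimal[OF zeroideal, of "{}"]
      additive_subgroup.zero_closed[OF ideal.axioms(1)[OF genideal_ideal[of "{}"]]] by auto
  then show ?case by (simp add: ideal_sum_empty)
next
  case (insert a A)
  let ?T = "\<Union>i\<in>A. S i"
  have S: "S a \<subseteq> carrier R" and T: "?T \<subseteq> carrier R" using insert.prems by auto
  have ST: "S a \<union> ?T \<subseteq> carrier R" using S T by blast
  note iS = genideal_ideal[OF S] and iT = genideal_ideal[OF T] and iST = genideal_ideal[OF ST]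
  have iU: "ideal (Idl (S a) <+>\<^bsub>R\<^esub> Idl ?T) R" by (rule add_ideals[OF iS iT])
  have "Idl (S a) \<union> Idl ?T \<subseteq> carrier R"
    using iS iT by (meson Un_least additive_subgroup.a_subset ideal.axioms(1))
  then have "Idl (S a) \<union> Idl ?T \<subseteq> Idl (S a) <+>\<^bsub>R\<^esub> Idl ?T"
    using union_genideal[OF iS iT] genideal_self by metis
  then have "S a \<union> ?T \<subseteq> Idl (S a) <+>\<^bsub>R\<^esub> Idl ?T"
    using genideal_self[OF S] genideal_self[OF T] by blast
  then have le: "Idl (S a \<union> ?T) \<subseteq> Idl (S a) <+>\<^bsub>R\<^esub> Idl ?T"
    by (rule genideal_minimal[OF iU])
  have "Idl (S a) \<union> Idl ?T \<subseteq> Idl (S a \<union> ?T)"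
    using genideal_minimal[OF iST, of "S a"] genideal_minimal[OF iST, of ?T]
      genideal_self[OF ST] by blast
  then have ge: "Idl (S a) <+>\<^bsub>R\<^esub> Idl ?T \<subseteq> Idl (S a \<union> ?T)"
    using genideal_minimal[OF iST] union_genideal[OF iS iT] by metis
  have "Idl (S i) \<subseteq> carrier R" if "i \<in> insert a A" for i
    using genideal_ideal[OF insert.prems[OF that]]
    by (meson additive_subgroup.a_subset ideal.axioms(1))
  then have "ideal_sum R (insert a A) (\<lambda>i. Idl (S i))
      = Idl (S a) <+>\<^bsub>R\<^esub> ideal_sum R A (\<lambda>i. Idl (S i))"
    using insert.hyps by (intro ideal_sum_insert) auto
  also have "\<dots> = Idl (S a) <+>\<^bsub>R\<^esub> Idl ?T" using insert by simp
  also have "\<dots> = Idl (S a \<union> ?T)" using le ge by blast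
  finally show ?case by simp
qed

end

section \<open>Squarefree monomials\<close>

lemma sqfree_monom_closed:
  assumes "W \<subseteq> {1..n}"
  shows "(sqfree_monom W :: 'k::field mpoly) \<in> carrier (mpoly_ring n)"
proof -
  let ?R = "mpoly_ring n :: 'k mpoly ring"
  interpret R: cring ?R by (rule cring_mpoly_ring)
  have "finite W" using assms finite_subset by blast
  then show ?thesis using assms
  proof (induction W rule: finite_induct)
    case empty
    then show ?case using R.one_closed by (simp add: sqfree_monom_def mpoly_ring_def)
  next
    case (insert a W)
    have "(var a :: 'k mpoly) \<in> carrier ?R"
      using insert.prems by (simp add: var_def mpoly_ring_def)
    then have "var a * sqfree_monom W \<in> carrier ?R"
      using insert R.m_closed[of "var a" "sqfree_monom W"] by (simp add: mpoly_ring_def)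
    then show ?case using insert.hyps by (simp add: sqfree_monom_def)
  qed
qed

lemma sqfree_monom_pair: "a \<noteq> b \<Longrightarrow> sqfree_monom {a, b} = var a * var b"
  by (simp add: sqfree_monom_def)

lemma sqfree_monom_in_ideal:
  assumes "ideal I (mpoly_ring n :: 'k::field mpoly ring)"
    and "(sqfree_monom U :: 'k mpoly) \<in> I" and "U \<subseteq> W" "W \<subseteq> {1..n}"
  shows "(sqfree_monom W :: 'k mpoly) \<in> I"
proof -
  have "finite W" using assms(4) finite_subset by blast
  then have eq: "(sqfree_monom W :: 'k mpoly) = sqfree_monom (W - U) * sqfree_monom U"
    unfolding sqfree_monom_def using \<open>U \<subseteq> W\<close> by (rule prod.subset_diff[rotated])
  have "(sqfree_monom (W - U) :: 'k mpoly) \<in> carrier (mpoly_ring n)"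
    using assms(4) by (intro sqfree_monom_closed) blast
  from ideal.I_l_closed[OF assms(1,2) this] show ?thesis
    by (simp add: eq mpoly_ring_def)
qed

text \<open>The next two lemmas bring both kinds of ideals into the common form \<open>Idl (sqfree_monom ` \<W>)\<close>,
  so that they can be compared through their set systems \<open>\<W>\<close>.\<close>

lemma edge_ideal_eq_genideal:
  assumes "simple_graph {1..n} H"
  shows "(edge_ideal n H :: 'k::field mpoly set) = Idl\<^bsub>mpoly_ring n\<^esub> (sqfree_monom ` H)"
proof -
  have card: "card e = 2" if "e \<in> H" for e using assms that by (auto simp: simple_graph_def)
  have "{var i * var j | i j. {i, j} \<in> H} = (sqfree_monom ` H :: 'k mpoly set)"
  proof (intro equalityI subsetI)
    fix x :: "'k mpoly" assume "x \<in> {var i * var j | i j. {i, j} \<in> H}"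
    then obtain i j where ij: "{i, j} \<in> H" and x: "x = var i * var j" by blast
    have "i \<noteq> j" using card[OF ij] by auto
    then show "x \<in> sqfree_monom ` H" using ij x by (metis sqfree_monom_pair image_eqI)
  next
    fix x :: "'k mpoly" assume "x \<in> sqfree_monom ` H"
    then obtain e where e: "e \<in> H" and x: "x = sqfree_monom e" by blast
    obtain i j where "e = {i, j}" "i \<noteq> j" using card[OF e] by (auto simp: card_2_iff)
    then show "x \<in> {var i * var j | i j. {i, j} \<in> H}"
      using e x sqfree_monom_pair by blast
  qed
  then show ?thesis by (simp add: edge_ideal_def)
qed

lemma nbhd_ideal_eq_genideal:
  assumes "\<And>i. i \<in> {1..n} \<Longrightarrow> closed_nbhd E i \<subseteq> {1..n}"
  shows "(nbhd_ideal n E k :: 'k::field mpoly set) = Idl\<^bsub>mpoly_ring n\<^esub>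
    (sqfree_monom ` (\<Union>i\<in>{1..n}. {W. W \<subseteq> closed_nbhd E i \<and> card W = k i}))"
proof -
  interpret R: cring "mpoly_ring n :: 'k mpoly ring" by (rule cring_mpoly_ring)
  let ?S = "\<lambda>i. {sqfree_monom W :: 'k mpoly | W. W \<subseteq> closed_nbhd E i \<and> card W = k i}"
  have "?S i \<subseteq> carrier (mpoly_ring n)" if "i \<in> {1..n}" for i
    using assms[OF that] sqfree_monom_closed by blast
  then have "nbhd_ideal n E k = Idl\<^bsub>mpoly_ring n\<^esub> (\<Union>i\<in>{1..n}. ?S i)"
    unfolding nbhd_ideal_def by (intro R.ideal_sum_genideal) auto
  moreover have "(\<Union>i\<in>{1..n}. ?S i)
      = sqfree_monom ` (\<Union>i\<in>{1..n}. {W. W \<subseteq> closed_nbhd E i \<and> card W = k i})"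
    by blast
  ultimately show ?thesis by simp
qed

text \<open>For squarefree monomials divisibility is inclusion of supports, so a member of \<open>\<W>\<close> with a
  subset in \<open>\<H>\<close> is a redundant generator. Below, \<open>\<H>\<close> consists of the edges and \<open>\<W>\<close> also
  contains the full closed neighbourhoods of the vertices outside the dominating set.\<close>

lemma genideal_sqfree_monom_cofinal:
  assumes "\<H> \<subseteq> \<W>" and "\<And>W. W \<in> \<W> \<Longrightarrow> W \<subseteq> {1..n}"
    and "\<And>W. W \<in> \<W> \<Longrightarrow> \<exists>U\<in>\<H>. U \<subseteq> W"
  shows "Idl\<^bsub>mpoly_ring n\<^esub> (sqfree_monom ` \<W>)
    = (Idl\<^bsub>mpoly_ring n\<^esub> (sqfree_monom ` \<H>) :: 'k::field mpoly set)"
proof -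
  let ?R = "mpoly_ring n :: 'k mpoly ring"
  interpret R: cring ?R by (rule cring_mpoly_ring)
  have W: "sqfree_monom ` \<W> \<subseteq> carrier ?R"
    using sqfree_monom_closed[OF assms(2)] by (rule image_subsetI)
  have H: "sqfree_monom ` \<H> \<subseteq> carrier ?R"
    using image_mono[OF assms(1)] W by (rule order_trans)
  have "sqfree_monom ` \<W> \<subseteq> Idl\<^bsub>?R\<^esub> (sqfree_monom ` \<H>)"
  proof (rule image_subsetI)
    fix W assume "W \<in> \<W>"
    then obtain U where U: "U \<in> \<H>" "U \<subseteq> W" using assms(3) by blast
    have "sqfree_monom U \<in> Idl\<^bsub>?R\<^esub> (sqfree_monom ` \<H>)"
      using R.genideal_self[OF H] imageI[OF U(1)] by (rule subsetD)
    then show "sqfree_monom W \<in> Idl\<^bsub>?R\<^esub> (sqfree_monom ` \<H>)"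
      using U(2) assms(2)[OF \<open>W \<in> \<W>\<close>]
      by (rule sqfree_monom_in_ideal[OF R.genideal_ideal[OF H]])
  qed
  then have "Idl\<^bsub>?R\<^esub> (sqfree_monom ` \<W>) \<subseteq> Idl\<^bsub>?R\<^esub> (sqfree_monom ` \<H>)"
    by (rule R.genideal_minimal[OF R.genideal_ideal[OF H]])
  moreover have "Idl\<^bsub>?R\<^esub> (sqfree_monom ` \<H>) \<subseteq> Idl\<^bsub>?R\<^esub> (sqfree_monom ` \<W>)"
    using image_mono[OF assms(1)] R.genideal_self[OF W]
    by (intro R.genideal_minimal[OF R.genideal_ideal[OF W]]) (rule order_trans)
  ultimately show ?thesis by blast
qed

section \<open>Closed neighbourhoods\<close>

lemma closed_nbhd_subset: "simple_graph V E \<Longrightarrow> i \<in> V \<Longrightarrow> closed_nbhd E i \<subseteq> V"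
  by (auto simp: simple_graph_def closed_nbhd_def nbhd_def)

lemma closed_nbhd_commute: "j \<in> closed_nbhd E i \<longleftrightarrow> i \<in> closed_nbhd E j"
  by (auto simp: closed_nbhd_def nbhd_def insert_commute)

lemma card_closed_nbhd:
  assumes "simple_graph V E" "i \<in> V"
  shows "card (closed_nbhd E i) = degree E i + 1"
proof -
  have "finite (closed_nbhd E i)"
    using closed_nbhd_subset[OF assms] assms(1) finite_subset by (auto simp: simple_graph_def)
  moreover have "i \<notin> nbhd E i" using assms(1) by (auto simp: nbhd_def simple_graph_def)
  ultimately show ?thesis by (simp add: closed_nbhd_def degree_def)
qed

section \<open>The neighbourhood ideal of a dominating set\<close>

theorem proposition4p1:
  fixes n :: nat and E :: "nat set set" and D :: "nat set" and k :: "nat \<Rightarrow> nat"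
  assumes "simple_graph {1..n} E"
    and "no_isolated_vertices {1..n} E"
    and "dominating_set {1..n} E D"
    and "\<And>i. i \<in> {1..n} \<Longrightarrow> k i = (if i \<in> D then 2 else degree E i + 1)"
  shows "\<exists>H. simple_graph {1..n} H \<and>
    (nbhd_ideal n E k :: 'k::field mpoly set) = edge_ideal n H"
proof -
  let ?N = "closed_nbhd E"
  define H where "H = {e. card e = 2 \<and> (\<exists>d\<in>D. e \<subseteq> ?N d)}"
  define \<W> where "\<W> = (\<Union>i\<in>{1..n}. {W. W \<subseteq> ?N i \<and> card W = k i})"
  have D: "D \<subseteq> {1..n}" using assms(3) by (simp add: dominating_set_def)
  have N: "?N i \<subseteq> {1..n}" if "i \<in> {1..n}" for i
    using closed_nbhd_subset[OF assms(1) that] .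
  have graph: "simple_graph {1..n} H"
    using D N unfolding simple_graph_def H_def by blast
  have "H \<subseteq> \<W>"
  proof
    fix e assume "e \<in> H"
    then obtain d where "d \<in> D" "e \<subseteq> ?N d" "card e = 2" by (auto simp: H_def)
    moreover have "k d = 2" using \<open>d \<in> D\<close> D assms(4) by auto
    ultimately show "e \<in> \<W>" using D unfolding \<W>_def by auto
  qed
  moreover have "W \<subseteq> {1..n}" if "W \<in> \<W>" for W
    using that N unfolding \<W>_def by blast
  moreover have "\<exists>U\<in>H. U \<subseteq> W" if "W \<in> \<W>" for W
  proof -
    obtain i where i: "i \<in> {1..n}" and W: "W \<subseteq> ?N i" "card W = k i"
      using \<open>W \<in> \<W>\<close> by (auto simp: \<W>_def)
    show ?thesis
    proof (cases "i \<in> D")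
      case True
      then have "W \<in> H" using W assms(4)[OF i] by (auto simp: H_def)
      then show ?thesis by blast
    next
      case False
      have "card W = card (?N i)"
        using False W assms(4)[OF i] card_closed_nbhd[OF assms(1) i] by simp
      moreover have "finite (?N i)" using N[OF i] finite_subset by blast
      ultimately have WN: "W = ?N i" using W(1) by (simp add: card_subset_eq)
      obtain d where d: "d \<in> D" "d \<in> ?N i"
        using assms(3) i unfolding dominating_set_def by blast
      have "{i, d} \<subseteq> ?N d"
        using d(2) closed_nbhd_commute[of d E i] by (simp add: closed_nbhd_def)
      moreover have "card {i, d} = 2" using False d(1) by (metis card_2_iff)
      ultimately have "{i, d} \<in> H" using d(1) by (auto simp: H_def)
      moreover have "{i, d} \<subseteq> W" using d(2) WN by (simp add: closed_nbhd_def)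
      ultimately show ?thesis by blast
    qed
  qed
  ultimately have "(Idl\<^bsub>mpoly_ring n\<^esub> (sqfree_monom ` \<W>) :: 'k mpoly set)
      = Idl\<^bsub>mpoly_ring n\<^esub> (sqfree_monom ` H)"
    by (rule genideal_sqfree_monom_cofinal)
  moreover have "(nbhd_ideal n E k :: 'k mpoly set) = Idl\<^bsub>mpoly_ring n\<^esub> (sqfree_monom ` \<W>)"
    unfolding \<W>_def using N by (rule nbhd_ideal_eq_genideal)
  ultimately have "(nbhd_ideal n E k :: 'k mpoly set) = edge_ideal n H"
    by (simp only: edge_ideal_eq_genideal[OF graph])
  then show ?thesis using graph by blast
qed

end
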